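(* Let $t^{(e)}(n)$ denote the number of e-squarefree e-divisors of $n$; it is the multiplicative function with $t^{(e)}(1)=1$ and $t^{(e)}(p^a)=2^{\omega(a)}$ for every prime $p$ and every $a\ge 1$. Then \[ \limsup_{n\to\infty}\frac{\log t^{(e)}(n)\,\log\log n}{\log n}=\frac12\log 2. \]
   Context: $\omega(m)$ denotes the number of distinct prime divisors of $m$ (so $\omega(1)=0$). For $n=p_1^{a_1}\cdots p_r^{a_r}>1$ (canonical prime factorization), an exponential divisor (e-divisor) of $n$ is an integer $d=p_1^{b_1}\cdots p_r^{b_r}$ with $b_i\mid a_i$ ($b_i\ge1$) for all $i$; by convention $1$ is the only e-divisor of $1$. The e-divisor $d$ is e-squarefree if all $b_1,\dots,b_r$ are squarefree; $1$ is e-squarefree by convention. Hence $t^{(e)}(n)=2^{\omega(a_1)}\cdots2^{\omega(a_r)}$. *)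

theory Defs
  imports Complex_Main
    "HOL-Library.Liminf_Limsup"
    "HOL-Library.Extended_Real"
    "HOL-Computational_Algebra.Computational_Algebra"
begin

definition omega :: "nat \<Rightarrow> nat" where
  "omega m = card (prime_factors m)"

(* Equality of the sets of prime factors expresses that all exponents b_i of d are at least 1
   and that d has no further primes; for n = 1 it forces d = 1. *)
definition e_divisor :: "nat \<Rightarrow> nat \<Rightarrow> bool" where
  "e_divisor d n \<longleftrightarrow> d > 0 \<and> n > 0 \<and> prime_factors d = prime_factors n \<and>
     (\<forall>p\<in>prime_factors n. multiplicity p d dvd multiplicity p n)"

definition e_squarefree :: "nat \<Rightarrow> bool" where
  "e_squarefree d \<longleftrightarrow> d > 0 \<and> (\<forall>p\<in>prime_factors d. squarefree (multiplicity p d))"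

definition t_e :: "nat \<Rightarrow> nat" where
  "t_e n = card {d. e_divisor d n \<and> e_squarefree d}"

end

theory Submission
  imports Defs "HOL-Real_Asymp.Real_Asymp"
begin

text \<open>
  An e-squarefree e-divisor of \<open>n\<close> is a free choice, for each prime \<open>p\<close> dividing \<open>n\<close> to the exact
  power \<open>a\<^sub>p\<close>, of a squarefree divisor of \<open>a\<^sub>p\<close>; there are \<open>2\<close> to the \<open>\<omega>(a\<^sub>p)\<close> of these. This is
  \<open>t_e_eq_prod\<close>: it contains the multiplicativity and the values at prime powers, and it gives
  \<open>log (t_e n) = log 2 \<cdot> \<Sum> \<omega>(a\<^sub>p)\<close>.

  A large value needs many units of \<open>\<omega>(a\<^sub>p)\<close> from small primes at little cost in \<open>\<Sum> a\<^sub>p log p = log n\<close>.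
  The cheapest unit is bought with exponent \<open>2\<close>, because \<open>\<omega>(a) \<le> a/2\<close>, and a prime near \<open>log n\<close>
  costs about \<open>log log n\<close> per unit of exponent. That is where the constant \<open>1/2\<close> comes from.

  For the upper bound (\<open>ln_t_e_le\<close>), the primes are split at a parameter \<open>y\<close>. Those above \<open>y\<close>
  contribute at most \<open>\<Sum> a\<^sub>p/2 \<le> log n / (2 log y)\<close>. Those below \<open>y\<close> are at most \<open>y\<close> in number and
  contribute only \<open>\<omega>(a\<^sub>p) \<le> log\<^sub>2 a\<^sub>p\<close> each, which is at most of the order of \<open>log log n\<close>. Choosing \<open>y\<close> as \<open>log n\<close>
  divided by a power of \<open>log log n\<close> makes the second part negligible without changing \<open>log y \<sim> log log n\<close>.

  The bound is attained asymptotically along the squares \<open>n\<close> of the products of the primes up to \<open>N\<close>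
  (\<open>square_primorial_ratio_ge\<close>): there \<open>t_e n\<close> is \<open>2\<close> to the \<open>\<pi>(N)\<close> and \<open>log n \<le> 2 \<pi>(N) log N\<close>.
  What remains is to see that \<open>log (\<pi>(N) log N)\<close> is asymptotically at least \<open>log N\<close>. For this a bound
  \<open>\<pi>(N) log N \<ge> c (N - 1)\<close> of Chebyshev's type suffices, which follows from the fact that a common multiple of \<open>1, \<dots>, N\<close> is at least \<open>2\<close> to the \<open>N - 1\<close>.
\<close>

section \<open>Counting numbers by their exponents\<close>

text \<open>
  Unique factorization as a counting principle: a number supported on \<open>P\<close> is the same thing as its
  family of exponents. It is applied to two kinds of exponent sets below: \<open>{0, 1}\<close> for the squarefree
  divisors of an exponent, and the sets of squarefree divisors themselves for \<open>t_e\<close>.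
\<close>

lemma card_prescribed_multiplicities:
  fixes P :: "nat set"
  assumes fin: "finite P" and pr: "\<And>p. p \<in> P \<Longrightarrow> prime p"
  shows "card {d. d > 0 \<and> prime_factors d \<subseteq> P \<and> (\<forall>p\<in>P. multiplicity p d \<in> B p)}
           = (\<Prod>p\<in>P. card (B p))"
proof -
  let ?D = "{d. d > 0 \<and> prime_factors d \<subseteq> P \<and> (\<forall>p\<in>P. multiplicity p d \<in> B p)}"
  define g :: "(nat \<Rightarrow> nat) \<Rightarrow> nat" where "g b = (\<Prod>p\<in>P. p ^ b p)" for b
  have mult_g: "multiplicity p (g b) = (if p \<in> P then b p else 0)" if "prime p" for p b
    unfolding g_def using multiplicity_prod_prime_powers[OF fin pr that] by blast
  have g_pos: "g b > 0" for b
    unfolding g_def using pr by (intro prod_pos) (auto simp: prime_gt_0_nat)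
  have "bij_betw g (PiE P B) ?D"
    unfolding bij_betw_def
  proof
    show "inj_on g (PiE P B)"
    proof (rule inj_onI)
      fix b c assume b: "b \<in> PiE P B" and c: "c \<in> PiE P B" and eq: "g b = g c"
      show "b = c"
      proof (rule PiE_ext[OF b c])
        fix p assume "p \<in> P"
        then show "b p = c p"
          using mult_g[of p b] mult_g[of p c] eq pr by simp
      qed
    qed
    show "g ` PiE P B = ?D"
    proof
      show "g ` PiE P B \<subseteq> ?D"
        using g_pos mult_g pr by (auto simp: prime_factors_multiplicity split: if_splits)
      show "?D \<subseteq> g ` PiE P B"
      proof
        fix d assume d: "d \<in> ?D"
        define b where "b = restrict (\<lambda>p. multiplicity p d) P"
        have "g b = d"
        proof (rule multiplicity_eq_nat)
          fix p :: nat assume "prime p"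
          then show "multiplicity p (g b) = multiplicity p d"
            using d by (auto simp: mult_g b_def prime_factors_multiplicity)
        qed (use d g_pos in auto)
        moreover have "b \<in> PiE P B"
          using d by (auto simp: b_def)
        ultimately show "d \<in> g ` PiE P B" by blast
      qed
    qed
  qed
  then have "card (PiE P B) = card ?D"
    by (rule bij_betw_same_card)
  then show ?thesis
    by (simp only: card_PiE[OF fin])
qed

lemma card_squarefree_divisors:
  assumes "a > 0"
  shows "card {b. b dvd a \<and> squarefree b} = 2 ^ omega a"
proof -
  have "{b. b dvd a \<and> squarefree b} =
     {d. d > 0 \<and> prime_factors d \<subseteq> prime_factors a \<and> (\<forall>p\<in>prime_factors a. multiplicity p d \<in> {0, 1})}"
     (is "?L = ?R")
  proof
    show "?L \<subseteq> ?R"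
    proof
      fix b assume b: "b \<in> ?L"
      then have "b > 0" using assms by (auto intro: Nat.gr0I)
      moreover have "prime_factors b \<subseteq> prime_factors a"
        using b assms by (intro dvd_prime_factors) auto
      moreover have "\<forall>p\<in>prime_factors a. multiplicity p b \<in> {0, 1}"
        using b \<open>b > 0\<close> squarefree_factorial_semiring''[of b]
        by (fastforce simp: le_Suc_eq)
      ultimately show "b \<in> ?R" by simp
    qed
    show "?R \<subseteq> ?L"
    proof
      fix d assume d: "d \<in> ?R"
      have *: "multiplicity p d \<le> 1 \<and> multiplicity p d \<le> multiplicity p a" if "prime p" for p
      proof (cases "p \<in> prime_factors a")
        case True
        then have "multiplicity p d \<in> {0, 1}" using d by blast
        moreover have "multiplicity p a > 0" using True by (simp add: prime_factors_multiplicity)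
        ultimately show ?thesis by auto
      next
        case False
        then have "p \<notin> prime_factors d" using d by blast
        then show ?thesis using that by (simp add: prime_factors_multiplicity)
      qed
      then have "d dvd a" 
        using d by (intro multiplicity_le_imp_dvd) auto
      moreover have "squarefree d"
        using d * by (subst squarefree_factorial_semiring'') auto
      ultimately show "d \<in> ?L" by simp
    qed
  qed
  also have "card \<dots> = (\<Prod>p\<in>prime_factors a. card {0, 1 :: nat})"
    by (rule card_prescribed_multiplicities) auto
  also have "\<dots> = 2 ^ omega a"
    by (simp add: omega_def numeral_2_eq_2)
  finally show ?thesis .
qed

text \<open>
  The exponents \<open>b\<^sub>p\<close> of an e-divisor are chosen independently. A squarefree number is nonzero, so
  the condition on the exponents already forces every prime of \<open>n\<close> to occur in the divisor.
\<close>

lemma t_e_eq_prod: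
  assumes "n > 0"
  shows "t_e n = (\<Prod>p\<in>prime_factors n. 2 ^ omega (multiplicity p n))"
proof -
  let ?B = "\<lambda>p. {b. b dvd multiplicity p n \<and> squarefree b}"
  have "{d. e_divisor d n \<and> e_squarefree d} =
     {d. d > 0 \<and> prime_factors d \<subseteq> prime_factors n \<and> (\<forall>p\<in>prime_factors n. multiplicity p d \<in> ?B p)}"
    (is "?L = ?R")
  proof
    show "?L \<subseteq> ?R" by (auto simp: e_divisor_def e_squarefree_def)
    show "?R \<subseteq> ?L"
    proof
      fix d assume d: "d \<in> ?R"
      have "p \<in> prime_factors d" if "p \<in> prime_factors n" for p
      proof -
        have "squarefree (multiplicity p d)" using d that by blast
        then have "multiplicity p d \<noteq> 0" by (metis not_squarefree_0)
        then show ?thesis using that by (auto simp: prime_factors_multiplicity)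
      qed
      then show "d \<in> ?L" using d assms by (auto simp: e_divisor_def e_squarefree_def)
    qed
  qed
  then have "t_e n = card ?R" by (simp only: t_e_def)
  also have "\<dots> = (\<Prod>p\<in>prime_factors n. card (?B p))"
    by (rule card_prescribed_multiplicities) auto
  also have "\<dots> = (\<Prod>p\<in>prime_factors n. 2 ^ omega (multiplicity p n))"
    by (intro prod.cong refl card_squarefree_divisors) (auto simp: prime_factors_multiplicity)
  finally show ?thesis .
qed

lemma t_e_mult:
  assumes "m > 0" "n > 0" "coprime m n"
  shows "t_e (m * n) = t_e m * t_e n"
proof -
  have disj: "prime_factors m \<inter> prime_factors n = {}"
    using assms(3) by (auto simp: in_prime_factors_iff dest: coprime_common_divisor)
  have mult: "multiplicity p (m * n) = multiplicity p m + multiplicity p n" if "prime p" for p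
    using assms that by (intro prime_elem_multiplicity_mult_distrib) auto
  have left: "multiplicity p (m * n) = multiplicity p m" if "p \<in> prime_factors m" for p
  proof -
    have "prime p" "p \<notin> prime_factors n" using that disj by auto
    then show ?thesis using mult by (simp add: prime_factors_multiplicity)
  qed
  have right: "multiplicity p (m * n) = multiplicity p n" if "p \<in> prime_factors n" for p
  proof -
    have "prime p" "p \<notin> prime_factors m" using that disj by auto
    then show ?thesis using mult by (simp add: prime_factors_multiplicity)
  qed
  have "t_e (m * n) = (\<Prod>p\<in>prime_factors m \<union> prime_factors n. 2 ^ omega (multiplicity p (m * n)))"
    using assms by (simp add: t_e_eq_prod prime_factors_product)
  also have "\<dots> = (\<Prod>p\<in>prime_factors m. 2 ^ omega (multiplicity p (m * n))) *
                  (\<Prod>p\<in>prime_factors n. 2 ^ omega (multiplicity p (m * n)))"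
    using disj by (intro prod.union_disjoint) auto
  also have "\<dots> = t_e m * t_e n"
    unfolding t_e_eq_prod[OF assms(1)] t_e_eq_prod[OF assms(2)]
    by (intro arg_cong2[where f = "(*)"] prod.cong refl) (simp_all only: left right)
  finally show ?thesis .
qed

lemma t_e_prime_power:
  assumes "prime p" "a \<ge> 1"
  shows "t_e (p ^ a) = 2 ^ omega a"
proof -
  have factors: "prime_factors (p ^ a) = {p}"
    using assms by (simp add: prime_factorization_prime_power)
  have "p ^ a > 0"
    using assms prime_gt_0_nat by simp
  then show ?thesis
    using assms by (subst t_e_eq_prod) (simp_all only: factors prod.insert prod.empty finite.emptyI
        empty_iff not_False_eq_True mult_1_right multiplicity_prime_power prime_imp_prime_elem)
qed

lemma ln_t_e:
  assumes "n > 0"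
  shows "ln (real (t_e n)) = ln 2 * (\<Sum>p\<in>prime_factors n. real (omega (multiplicity p n)))"
  unfolding t_e_eq_prod[OF assms]
  by (simp add: ln_prod ln_realpow sum_distrib_left mult.commute)

section \<open>The upper bound\<close>

text \<open>The left-hand side counts the squarefree divisors of \<open>a\<close>, all of which lie in \<open>{1..a}\<close>.\<close>

lemma two_power_omega_le: "a > 0 \<Longrightarrow> 2 ^ omega a \<le> a"
proof -
  assume a: "a > 0"
  have "card {b. b dvd a \<and> squarefree b} \<le> card {1..a}"
    using a by (intro card_mono) (auto dest: dvd_imp_le intro!: Suc_leI Nat.gr0I)
  then show ?thesis using card_squarefree_divisors[OF a] by simp
qed

text \<open>
  Equality holds only at \<open>a = 2\<close>, so squares are the most economical prime powers for \<open>t_e\<close>.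
\<close>

lemma omega_le_half:
  assumes "a > 0"
  shows "2 * omega a \<le> a"
proof -
  have "2 * k \<le> 2 ^ k" for k :: nat
  proof (induction k)
    case (Suc k)
    then show ?case by (cases k) auto
  qed simp
  from this[of "omega a"] two_power_omega_le[OF assms] show ?thesis by linarith
qed

lemma ln_eq_sum_multiplicity:
  fixes n :: nat
  assumes "n > 0"
  shows "ln (real n) = (\<Sum>p\<in>prime_factors n. real (multiplicity p n) * ln (real p))"
proof -
  have "ln (real n) = ln (real (\<Prod>p\<in>prime_factors n. p ^ multiplicity p n))"
    using prod_prime_factors[of n] assms by simp
  also have "\<dots> = (\<Sum>p\<in>prime_factors n. ln (real p ^ multiplicity p n))"
    unfolding of_nat_prod of_nat_power by (intro ln_prod) (auto simp: prime_gt_0_nat dest: in_prime_factors_imp_prime)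
  also have "\<dots> = (\<Sum>p\<in>prime_factors n. real (multiplicity p n) * ln (real p))"
    by (intro sum.cong refl ln_realpow)
  finally show ?thesis .
qed

text \<open>
  The first summand bounds the contribution of the primes \<open>p \<le> y\<close>, the second that of the primes
  \<open>p > y\<close>. The parameter is left free so that its size can be balanced in the limit.
\<close>

lemma ln_t_e_le:
  fixes y :: real
  assumes n: "n > 1" and y: "y > 1"
  shows "ln (real (t_e n)) \<le> y * ln (ln (real n) / ln 2) + ln 2 / 2 * (ln (real n) / ln y)"
proof -
  define S where "S = {p \<in> prime_factors n. real p \<le> y}"
  define L where "L = {p \<in> prime_factors n. real p > y}"
  let ?a = "\<lambda>p. multiplicity p n"
  have a_pos: "?a p > 0" if "p \<in> prime_factors n" for p
    using that by (simp add: prime_factors_multiplicity)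
  have split: "prime_factors n = S \<union> L" "S \<inter> L = {}" and fin: "finite S" "finite L"
    by (auto simp: S_def L_def)
  \<comment> \<open>The estimate \<open>a\<^sub>p \<le> log\<^sub>2 n\<close> keeps \<open>\<omega>(a\<^sub>p)\<close> doubly logarithmic in \<open>n\<close>.\<close>
  have small: "ln 2 * real (omega (?a p)) \<le> ln (ln (real n) / ln 2)" if "p \<in> S" for p
  proof -
    have p: "p \<in> prime_factors n" using that by (simp add: S_def)
    have "real (2 ^ omega (?a p)) \<le> real (?a p)"
      using two_power_omega_le[OF a_pos[OF p]] of_nat_le_iff by blast
    also have "real (?a p) \<le> ln (real n) / ln 2"
    proof -
      have "2 ^ ?a p \<le> p ^ ?a p"
        using p by (intro power_mono) (auto simp: prime_ge_2_nat dest: in_prime_factors_imp_prime)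
      also have "\<dots> \<le> n"
        using n by (intro dvd_imp_le multiplicity_dvd) auto
      finally have "real (2 ^ ?a p) \<le> real n"
        using of_nat_le_iff by blast
      then have "ln (2 ^ ?a p) \<le> ln (real n)"
        using n by simp
      then show ?thesis
        by (simp add: ln_realpow field_simps)
    qed
    finally have "ln (2 ^ omega (?a p)) \<le> ln (ln (real n) / ln 2)"
      by (subst ln_le_cancel_iff) (auto intro: less_le_trans[rotated])
    then show ?thesis by (simp add: ln_realpow mult.commute)
  qed
  have card_S: "real (card S) \<le> y"
  proof -
    have "S \<subseteq> {1..nat \<lfloor>y\<rfloor>}"
      unfolding S_def
      by (auto simp: le_nat_floor Suc_le_eq prime_gt_0_nat dest: in_prime_factors_imp_prime)
    then have "card S \<le> nat \<lfloor>y\<rfloor>"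
      using card_mono[of "{1..nat \<lfloor>y\<rfloor>}" S] by simp
    then show ?thesis using y by linarith
  qed
  have nonneg: "0 \<le> ln (ln (real n) / ln 2)"
    using n by (intro ln_ge_zero) (simp add: field_simps)
  have "ln 2 * (\<Sum>p\<in>S. real (omega (?a p))) \<le> real (card S) * ln (ln (real n) / ln 2)"
    unfolding sum_distrib_left by (rule sum_bounded_above) (rule small)
  also have "\<dots> \<le> y * ln (ln (real n) / ln 2)"
    by (rule mult_right_mono[OF card_S nonneg])
  finally have S_bound: "ln 2 * (\<Sum>p\<in>S. real (omega (?a p))) \<le> y * ln (ln (real n) / ln 2)" .
  \<comment> \<open>For \<open>p > y\<close> the factor \<open>ln p / ln y\<close> exceeds \<open>1\<close>; inserting it turns \<open>\<Sum> a\<^sub>p\<close> into part of \<open>ln n\<close>.\<close>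
  have "(\<Sum>p\<in>L. real (omega (?a p))) \<le> (\<Sum>p\<in>L. real (?a p) * ln (real p) / (2 * ln y))"
  proof (rule sum_mono)
    fix p assume p: "p \<in> L"
    have "ln y \<le> ln (real p)" using p y by (simp add: L_def)
    then have "real (?a p) * ln y \<le> real (?a p) * ln (real p)"
      by (intro mult_left_mono) auto
    moreover have "2 * omega (?a p) \<le> ?a p"
      using p by (intro omega_le_half a_pos) (simp add: L_def)
    then have "2 * real (omega (?a p)) * ln y \<le> real (?a p) * ln y"
      using y by (intro mult_right_mono) auto
    ultimately have "2 * real (omega (?a p)) * ln y \<le> real (?a p) * ln (real p)"
      by linarith
    then show "real (omega (?a p)) \<le> real (?a p) * ln (real p) / (2 * ln y)"
      using y by (simp add: pos_le_divide_eq mult_ac)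
  qed
  also have "\<dots> = (\<Sum>p\<in>L. real (?a p) * ln (real p)) / (2 * ln y)"
    by (simp add: sum_divide_distrib)
  also have "\<dots> \<le> ln (real n) / (2 * ln y)"
  proof (rule divide_right_mono)
    have "(\<Sum>p\<in>L. real (?a p) * ln (real p)) \<le> (\<Sum>p\<in>prime_factors n. real (?a p) * ln (real p))"
      by (intro sum_mono2)
         (auto simp: L_def Suc_le_eq prime_gt_0_nat intro!: mult_nonneg_nonneg
               dest!: in_prime_factors_imp_prime)
    then show "(\<Sum>p\<in>L. real (?a p) * ln (real p)) \<le> ln (real n)"
      using ln_eq_sum_multiplicity[of n] n by simp
  qed (use y in auto)
  finally have "ln 2 * (\<Sum>p\<in>L. real (omega (?a p))) \<le> ln 2 * (ln (real n) / (2 * ln y))"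
    by (intro mult_left_mono) auto
  also have "\<dots> = ln 2 / 2 * (ln (real n) / ln y)" by simp
  finally have L_bound: "ln 2 * (\<Sum>p\<in>L. real (omega (?a p))) \<le> ln 2 / 2 * (ln (real n) / ln y)" .
  have "ln (real (t_e n)) = ln 2 * (\<Sum>p\<in>S. real (omega (?a p))) + ln 2 * (\<Sum>p\<in>L. real (omega (?a p)))"
    using n by (simp add: ln_t_e split(1) sum.union_disjoint[OF fin split(2)] distrib_left)
  then show ?thesis using S_bound L_bound by linarith
qed

lemma limsup_ln_t_e_le:
  "limsup (\<lambda>n::nat. ereal (ln (real (t_e n)) * ln (ln (real n)) / ln (real n))) \<le> ereal (1 / 2 * ln 2)"
proof -
  \<comment> \<open>The small primes contribute about \<open>y ln ln n\<close>, which has to be \<open>o(ln n / ln ln n)\<close>: an exponent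
      above \<open>2\<close> in the denominator achieves this, and \<open>ln (y n)\<close> is still asymptotic to \<open>ln ln n\<close>.\<close>
  define y where "y n = ln (real n) / ln (ln (real n)) ^ 3" for n :: nat
  define U where "U n = (y n * ln (ln (real n) / ln 2) + ln 2 / 2 * (ln (real n) / ln (y n)))
                          * ln (ln (real n)) / ln (real n)" for n :: nat
  have "eventually (\<lambda>n. y n > 1) sequentially"
    unfolding y_def by real_asymp
  moreover have "eventually (\<lambda>n::nat. ln (ln (real n)) > 0) sequentially"
    by real_asymp
  ultimately have "eventually (\<lambda>n. ereal (ln (real (t_e n)) * ln (ln (real n)) / ln (real n)) \<le> ereal (U n)) sequentially"
    using eventually_gt_at_top[of 1]
  proof eventually_elim
    case (elim n)
    have "0 < ln (real n)" using elim by simp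
    then show ?case unfolding U_def ereal_less_eq
      using elim ln_t_e_le[of n "y n"]
      by (intro divide_right_mono mult_right_mono) auto
  qed
  then have "limsup (\<lambda>n::nat. ereal (ln (real (t_e n)) * ln (ln (real n)) / ln (real n))) \<le> limsup (\<lambda>n. ereal (U n))"
    by (rule Limsup_mono)
  also have "U \<longlonglongrightarrow> 1 / 2 * ln 2"
    unfolding U_def y_def by real_asymp
  then have "limsup (\<lambda>n. ereal (U n)) = ereal (1 / 2 * ln 2)"
    by (intro lim_imp_Limsup) auto
  finally show ?thesis .
qed

section \<open>A Chebyshev bound for the number of primes\<close>

text \<open>
  The entries \<open>1 / ((m + 1) (m choose k))\<close> of Leibniz's harmonic triangle are differences of entries
  in the column before, and column \<open>0\<close> consists of the unit fractions \<open>1 / (m + 1)\<close>. So the entries in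
  the rows up to \<open>n\<close> are integer combinations of \<open>1/1, \<dots>, 1/(n + 1)\<close>, and \<open>D\<close> clears all their
  denominators.
\<close>

lemma binomial_le_of_common_multiple:
  fixes D :: nat
  assumes "D > 0" "\<And>j. 1 \<le> j \<Longrightarrow> j \<le> Suc n \<Longrightarrow> j dvd D" "k \<le> n"
  shows "Suc n * (n choose k) \<le> D"
proof -
  define l where "l m k = real D / (real (Suc m) * real (m choose k))" for m k
  have "l m k \<in> \<int>" if "k \<le> m" "m \<le> n" for m k
    using that
  proof (induction k arbitrary: m)
    case 0
    then obtain q where "D = Suc m * q" using assms(2)[of "Suc m"] by (auto elim: dvdE)
    then have "l m 0 = real q"
      unfolding l_def by (simp del: of_nat_Suc mult_Suc)
    then show ?case by simp
  next
    case (Suc k)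
    then obtain m' where m: "m = Suc m'" "k \<le> m'" by (cases m) auto
    have pos: "m' choose k > 0" "m choose k > 0" "m choose Suc k > 0"
      using Suc m by (auto simp del: binomial_Suc_Suc)
    have "Suc k * (m choose Suc k) = m * (m' choose k)"
      unfolding m by (rule Suc_times_binomial)
    then have 1: "real (Suc k) * real (m choose Suc k) = real m * real (m' choose k)"
      by (metis of_nat_mult)
    have "(m - k) * (m choose k) = m * (m' choose k)"
      using binomial_absorb_comp[of m k] m by simp
    then have 2: "(real m - real k) * real (m choose k) = real m * real (m' choose k)"
      using m by (metis of_nat_mult of_nat_diff le_SucI)
    have "real m - real k \<noteq> 0" "real m > 0" using m by auto
    have f: "real (m choose Suc k) = real m * real (m' choose k) / real (Suc k)"
      using 1 by (simp add: field_simps del: of_nat_Suc)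
    have e: "real (m choose k) = real m * real (m' choose k) / (real m - real k)"
      using 2 \<open>real m - real k \<noteq> 0\<close> by (simp add: field_simps)
    have "l m (Suc k) = l m' k - l m k"
      unfolding l_def f e using pos \<open>real m > 0\<close> \<open>real m - real k \<noteq> 0\<close> m(1)
      by (simp add: divide_simps) (simp add: algebra_simps)
    moreover have "l m' k \<in> \<int>" "l m k \<in> \<int>"
      using Suc m by auto
    ultimately show ?case by simp
  qed
  then have "l n k \<in> \<int>" using assms(3) by blast
  have pos: "real (Suc n) * real (n choose k) > 0" using assms(3) by simp
  then have "l n k > 0" using assms(1) unfolding l_def by (intro divide_pos_pos) auto
  then have "l n k \<ge> 1" using \<open>l n k \<in> \<int>\<close> by (auto elim!: Ints_cases)
  then have "real (Suc n) * real (n choose k) \<le> real D"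
    using pos unfolding l_def by (simp add: field_simps del: of_nat_Suc)
  then show ?thesis by (metis of_nat_le_iff of_nat_mult)
qed

text \<open>Averaging the preceding bound over row \<open>n\<close> of Pascal's triangle, whose sum is \<open>2\<close> to the \<open>n\<close>.\<close>

lemma two_power_le_of_common_multiple:
  fixes D :: nat
  assumes "D > 0" "\<And>j. 1 \<le> j \<Longrightarrow> j \<le> Suc n \<Longrightarrow> j dvd D"
  shows "2 ^ n \<le> D"
proof -
  have "Suc n * 2 ^ n = (\<Sum>k\<le>n. Suc n * (n choose k))"
    unfolding choose_row_sum[symmetric] by (simp add: sum_distrib_left)
  also have "\<dots> \<le> (\<Sum>k\<le>n. D)"
    by (intro sum_mono binomial_le_of_common_multiple[OF assms]) auto
  also have "\<dots> = Suc n * D" by simp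
  finally show ?thesis by (simp only: Suc_mult_le_cancel1)
qed

lemma finite_primes_upto: "finite {p::nat. prime p \<and> p \<le> N}"
  by (rule finite_subset[of _ "{..N}"]) auto

text \<open>
  The least common multiple of \<open>1, \<dots>, N\<close> is the product of the largest prime powers not exceeding
  \<open>N\<close>, one for each prime up to \<open>N\<close>; hence it is at most \<open>N\<close> to the \<open>\<pi>(N)\<close>.
\<close>

lemma two_power_le_power_card_primes:
  fixes N :: nat
  assumes "N \<ge> 1"
  shows "2 ^ (N - 1) \<le> N ^ card {p. prime p \<and> p \<le> N}"
proof -
  let ?P = "{p. prime p \<and> p \<le> N}"
  define e where "e p = (GREATEST i. p ^ i \<le> N)" for p :: nat
  have bd: "\<forall>i. p ^ i \<le> N \<longrightarrow> i \<le> N" if "prime p" for p :: nat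
  proof (intro allI impI)
    fix i assume "p ^ i \<le> N"
    have "i < 2 ^ i" by (rule less_exp)
    also have "\<dots> \<le> p ^ i" using prime_ge_2_nat[OF that] by (intro power_mono) auto
    finally show "i \<le> N" using \<open>p ^ i \<le> N\<close> by linarith
  qed
  have e_le: "p ^ e p \<le> N" if "prime p" for p
    unfolding e_def using assms bd[OF that] by (intro GreatestI_nat[of "\<lambda>i. p ^ i \<le> N" 0 N]) auto
  have le_e: "i \<le> e p" if "prime p" "p ^ i \<le> N" for p i
    unfolding e_def using that bd by (intro Greatest_le_nat[of "\<lambda>i. p ^ i \<le> N" i N]) auto
  define D where "D = (\<Prod>p\<in>?P. p ^ e p)"
  have D_pos: "D > 0"
    unfolding D_def by (intro prod_pos) (auto simp: prime_gt_0_nat)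
  have "j dvd D" if j: "1 \<le> j" "j \<le> Suc (N - 1)" for j
  proof (rule multiplicity_le_imp_dvd)
    fix p :: nat assume p: "prime p"
    have "p ^ multiplicity p j \<le> j"
      using j by (intro dvd_imp_le multiplicity_dvd) auto
    then have le: "p ^ multiplicity p j \<le> N" using j assms by linarith
    have "multiplicity p D = (if p \<in> ?P then e p else 0)"
      unfolding D_def by (rule multiplicity_prod_prime_powers[OF finite_primes_upto _ p]) auto
    moreover have "multiplicity p j = 0" if "p > N"
      using that j assms by (intro not_dvd_imp_multiplicity_0) (auto dest: dvd_imp_le)
    ultimately show "multiplicity p j \<le> multiplicity p D"
      using le_e[OF p le] p by (cases "p \<le> N") auto
  qed (use j in auto)
  then have "2 ^ (N - 1) \<le> D"
    by (rule two_power_le_of_common_multiple[OF D_pos])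
  also have "D \<le> (\<Prod>p\<in>?P. N)"
    unfolding D_def using e_le by (intro prod_mono) auto
  finally show ?thesis by simp
qed

section \<open>The lower bound\<close>

lemma t_e_square_primorial:
  fixes N :: nat
  shows "t_e (\<Prod>p | prime p \<and> p \<le> N. p ^ 2) = 2 ^ card {p. prime p \<and> p \<le> N}"
proof -
  let ?P = "{p. prime p \<and> p \<le> N}" and ?n = "\<Prod>p | prime p \<and> p \<le> N. p ^ 2"
  have mult: "multiplicity p ?n = (if p \<in> ?P then 2 else 0)" if "prime p" for p
    by (rule multiplicity_prod_prime_powers[OF finite_primes_upto _ that]) auto
  have "prime_factors ?n = ?P"
    using mult by (auto simp: prime_factors_multiplicity split: if_splits)
  moreover have "?n > 0" by (intro prod_pos) (auto simp: prime_gt_0_nat)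
  moreover have "omega 2 = 1"
    by (simp add: omega_def prime_factorization_prime)
  ultimately show ?thesis
    using mult by (simp add: t_e_eq_prod)
qed

text \<open>
  Injectivity of \<open>r\<close> cannot be asked for: the product of the primes up to \<open>N\<close> stays constant between
  two consecutive primes.
\<close>

lemma limsup_ge_of_subfamily:
  fixes f :: "nat \<Rightarrow> real"
  assumes lim: "g \<longlonglongrightarrow> c" and r: "filterlim r at_top sequentially"
    and le: "eventually (\<lambda>N. g N \<le> f (r N)) sequentially"
  shows "ereal c \<le> limsup (\<lambda>n. ereal (f n))"
proof (rule ccontr)
  assume "\<not> ?thesis"
  then obtain z where z: "limsup (\<lambda>n. ereal (f n)) < z" "z < ereal c"
    using dense not_le by metis
  have "eventually (\<lambda>N. ereal (f (r N)) < z) sequentially"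
    using Limsup_lessD[OF z(1)] r by (rule eventually_compose_filterlim)
  moreover have "eventually (\<lambda>N. z < ereal (g N)) sequentially"
    using lim z(2) by (intro order_tendstoD) auto
  ultimately have "eventually (\<lambda>N::nat. False) sequentially"
    using le by eventually_elim (meson ereal_less_eq(3) leD less_trans order.strict_trans2)
  then show False by simp
qed

text \<open>
  With \<open>x \<le> y\<close>, this lets an upper bound for \<open>log n\<close> be turned into a lower bound for
  \<open>log log n / log n\<close>.
\<close>

lemma ln_over_self_antimono:
  fixes x y :: real
  assumes "exp 1 \<le> x" "x \<le> y"
  shows "ln y / y \<le> ln x / x"
proof -
  have x: "x > 0" using assms exp_gt_zero[of "1::real"] by linarith
  have "ln (y / x) \<le> y / x - 1" using x assms by (intro ln_le_minus_one) auto
  moreover have "1 \<le> ln x" using assms x by (simp add: ln_ge_iff)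
  then have "1 * (y / x - 1) \<le> ln x * (y / x - 1)"
    using x assms by (intro mult_right_mono) (auto simp: field_simps)
  ultimately have "ln y - ln x \<le> ln x * (y / x - 1)"
    using x assms by (simp add: ln_div)
  then show ?thesis using x assms by (simp add: field_simps)
qed

text \<open>
  Since \<open>log n \<le> 2 k log N\<close> with \<open>k = \<pi>(N)\<close>, monotonicity of \<open>log x / x\<close> allows \<open>2 k log N\<close> in place of
  \<open>log n\<close>. The factor \<open>k\<close> then cancels against \<open>log t_e n = k log 2\<close>, and it survives only inside a
  logarithm, where the Chebyshev bound is accurate enough.
\<close>

lemma square_primorial_ratio_ge:
  fixes N :: nat
  assumes N: "N \<ge> 3"
  defines "n \<equiv> \<Prod>p | prime p \<and> p \<le> N. p ^ 2"
  shows "ln 2 * ln (2 * ln 2 * (real N - 1)) / (2 * ln (real N))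
           \<le> ln (real (t_e n)) * ln (ln (real n)) / ln (real n)"
proof -
  let ?P = "{p. prime p \<and> p \<le> N}"
  define k where "k = real (card ?P)"
  have "real (2 ^ (N - 1)) \<le> real (N ^ card ?P)"
    using two_power_le_power_card_primes[of N] N by (intro of_nat_mono) auto
  then have "ln (2 ^ (N - 1)) \<le> ln (real N ^ card ?P)"
    using N by (subst ln_le_cancel_iff) auto
  then have cheb: "ln 2 * (real N - 1) \<le> k * ln (real N)"
    using N by (simp add: k_def ln_realpow of_nat_diff mult.commute)
  have lnn: "ln (real n) = (\<Sum>p\<in>?P. 2 * ln (real p))"
    unfolding n_def of_nat_prod of_nat_power
    by (subst ln_prod) (auto simp: prime_gt_0_nat ln_realpow intro!: sum.cong)
  have upper: "ln (real n) \<le> 2 * k * ln (real N)"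
  proof -
    have "(\<Sum>p\<in>?P. 2 * ln (real p)) \<le> of_nat (card ?P) * (2 * ln (real N))"
    proof (rule sum_bounded_above)
      fix p assume "p \<in> ?P"
      then show "2 * ln (real p) \<le> 2 * ln (real N)"
        using prime_gt_0_nat[of p] by simp
    qed
    then show ?thesis using lnn by (simp add: k_def)
  qed
  \<comment> \<open>\<open>log x / x\<close> decreases only from \<open>e\<close> on; \<open>N \<ge> 3\<close> gives \<open>n \<ge> 36\<close>, which exceeds \<open>e\<close> to the \<open>e\<close>.\<close>
  have lower: "exp 1 \<le> ln (real n)"
  proof -
    have "36 dvd n" 
    proof -
      have "(\<Prod>p\<in>{2,3}. p ^ 2) dvd n"
        unfolding n_def using N by (intro prod_dvd_prod_subset finite_primes_upto) auto
      then show ?thesis by simp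
    qed
    moreover have "n > 0" unfolding n_def by (intro prod_pos) (auto simp: prime_gt_0_nat)
    ultimately have "36 \<le> n" by (rule dvd_imp_le)
    have "exp 1 \<le> (3::real)" by (rule exp_le)
    have "exp (exp 1) \<le> exp (3::real)" using exp_le by simp
    also have "exp (3::real) = exp 1 ^ 3" by (simp flip: exp_of_nat_mult)
    also have "\<dots> \<le> 3 ^ 3" using exp_le by (intro power_mono) auto
    also have "\<dots> \<le> real n" using \<open>36 \<le> n\<close> by simp
    finally show ?thesis using \<open>n > 0\<close> by (simp add: ln_ge_iff)
  qed
  have "2 \<in> ?P" using N by simp
  then have "card ?P > 0" using finite_primes_upto by (simp only: card_gt_0_iff) blast
  then have k_pos: "k > 0" unfolding k_def by (simp only: of_nat_0_less_iff)
  have lnN: "ln (real N) > 0" using N by simp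
  have "ln 2 * ln (2 * ln 2 * (real N - 1)) / (2 * ln (real N))
          \<le> ln 2 * ln (2 * k * ln (real N)) / (2 * ln (real N))"
    using cheb N lnN k_pos by (intro divide_right_mono mult_left_mono) auto
  also have "\<dots> = k * ln 2 * (ln (2 * k * ln (real N)) / (2 * k * ln (real N)))"
    using k_pos by (simp add: field_simps)
  also have "\<dots> \<le> k * ln 2 * (ln (ln (real n)) / ln (real n))"
    using k_pos by (intro mult_left_mono ln_over_self_antimono lower upper) auto
  also have "k * ln 2 = ln (real (t_e n))"
    unfolding n_def t_e_square_primorial k_def by (simp add: ln_realpow)
  finally show ?thesis by simp
qed

lemma filterlim_square_primorial:
  "filterlim (\<lambda>N::nat. \<Prod>p | prime p \<and> p \<le> N. p ^ 2) at_top sequentially"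
  unfolding filterlim_at_top
proof
  fix Z :: nat
  obtain q where q: "prime q" "q > Z" using bigger_prime by blast
  have "eventually (\<lambda>N. q \<le> N) sequentially" by (rule eventually_ge_at_top)
  then show "eventually (\<lambda>N::nat. Z \<le> (\<Prod>p | prime p \<and> p \<le> N. p ^ 2)) sequentially"
  proof eventually_elim
    case (elim N)
    have "q dvd q ^ 2" by simp
    also have "q ^ 2 dvd (\<Prod>p | prime p \<and> p \<le> N. p ^ 2)"
      using elim q by (intro dvd_prodI finite_primes_upto) auto
    finally have "q \<le> (\<Prod>p | prime p \<and> p \<le> N. p ^ 2)"
      by (rule dvd_imp_le) (auto intro!: prod_pos simp: prime_gt_0_nat)
    then show ?case using q by simp
  qed
qed

lemma limsup_ln_t_e_ge:
  "ereal (1 / 2 * ln 2) \<le> limsup (\<lambda>n::nat. ereal (ln (real (t_e n)) * ln (ln (real n)) / ln (real n)))"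
proof (rule limsup_ge_of_subfamily[OF _ filterlim_square_primorial])
  show "(\<lambda>N::nat. ln 2 * ln (2 * ln 2 * (real N - 1)) / (2 * ln (real N))) \<longlonglongrightarrow> 1 / 2 * ln 2"
    by real_asymp
  show "eventually (\<lambda>N::nat. ln 2 * ln (2 * ln 2 * (real N - 1)) / (2 * ln (real N))
      \<le> ln (real (t_e (\<Prod>p | prime p \<and> p \<le> N. p ^ 2))) *
         ln (ln (real (\<Prod>p | prime p \<and> p \<le> N. p ^ 2))) / ln (real (\<Prod>p | prime p \<and> p \<le> N. p ^ 2))) sequentially"
    using eventually_ge_at_top[of 3] by eventually_elim (rule square_primorial_ratio_ge)
qed

theorem theorem5:
  shows "t_e 1 = 1
    \<and> (\<forall>m n. m > 0 \<longrightarrow> n > 0 \<longrightarrow> coprime m n \<longrightarrow> t_e (m * n) = t_e m * t_e n)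
    \<and> (\<forall>p a. prime p \<longrightarrow> a \<ge> 1 \<longrightarrow> t_e (p ^ a) = 2 ^ omega a)
    \<and> limsup (\<lambda>n::nat. ereal (ln (real (t_e n)) * ln (ln (real n)) / ln (real n)))
        = ereal (1 / 2 * ln 2)"
proof (intro conjI allI impI)
  show "t_e 1 = 1" by (simp add: t_e_eq_prod)
  show "limsup (\<lambda>n::nat. ereal (ln (real (t_e n)) * ln (ln (real n)) / ln (real n)))
          = ereal (1 / 2 * ln 2)"
    by (rule antisym[OF limsup_ln_t_e_le limsup_ln_t_e_ge])
qed (simp_all only: t_e_mult t_e_prime_power)

end
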